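(* Let $\mathbf{A}\in\mathbb{R}^{n\times m}$, $\mathbf{y}\in\mathbb{N}^n$, $\bm{\mu}_0\in\mathbb{R}^m$, $\bar{\mathbf{C}}_0\in\mathcal{S}_m^+$, and let $a,b>0$ be the parameters of a Gamma distribution. For $\alpha>0$ let $(\mathbf{\bar x}_\alpha,\mathbf{C}_\alpha)$ be the unique maximizer over $\mathbb{R}^m\times\mathcal{S}_m^+$ of $$F_\alpha(\mathbf{\bar{x}},\mathbf{C}) = (\mathbf{y},\mathbf{A}\mathbf{\bar{x}})- (\mathbf{1}_n,e^{\mathbf{A}\mathbf{\bar{x}}+\frac{1}{2}\mathrm{diag}(\mathbf{A}\mathbf{C}\mathbf{A}^t)}) - \tfrac{\alpha}{2}(\mathbf{\bar{x}}-\bm{\mu}_0)^t\bar{\mathbf{C}}^{-1}_0(\mathbf{\bar{x}}-\bm{\mu}_0) - \tfrac{\alpha}{2}\mathrm{tr}(\bar{\mathbf{C}}^{-1}_0\mathbf{C})+ \tfrac{1}{2}\ln|\mathbf{C}| +\tfrac{m}{2}\ln\alpha- \tfrac{1}{2}\ln|\bar{\mathbf{C}}_0| + \tfrac{m}{2} - (\mathbf{1}_n,\ln(\mathbf{y}!)).$$ Given an initial guess $\alpha^1>0$, let the sequence $\{\alpha^k\}_{k\ge1}$ be generated by $$\alpha^{k+1}=\frac{m+2(a-1)}{(\mathbf{\bar{x}}_{\alpha^k}-\bm{\mu}_0)^t\bar{\mathbf{C}}_0^{-1}(\mathbf{\bar{x}}_{\alpha^k}-\bm{\mu}_0)+\mathrm{tr}(\bar{\mathbf{C}}_0^{-1}\mathbf{C}_{\alpha^k})+2b},\qquad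 k\ge1.$$ Then, for any initial guess $\alpha^1>0$, the sequence $\{\alpha^k\}$ is monotonically convergent to some $\alpha^*\ge0$; and if the limit $\alpha^*>0$, then it satisfies the fixed point equation $$\alpha^* = \frac{m+2(a-1)}{(\mathbf{\bar{x}}_{\alpha^*}-\bm{\mu}_0)^t\bar{\mathbf{C}}_0^{-1}(\mathbf{\bar{x}}_{\alpha^*}-\bm{\mu}_0)+\mathrm{tr}(\bar{\mathbf{C}}_0^{-1}\mathbf{C}_{\alpha^*})+2b}.$$
   Context: $\mathbb{N}=\{0,1,2,\ldots\}$. $\mathcal{S}_m^+$ is the set of real symmetric positive definite $m\times m$ matrices, $|\cdot|$ is the determinant, $\mathrm{tr}$ is the trace, the superscript $t$ denotes transpose, and $(\cdot,\cdot)$ is the Euclidean inner product. $\mathbf{1}_n\in\mathbb{R}^n$ is the all-ones vector. Exponential, logarithm and factorial of a vector are taken componentwise. For a square matrix $\mathbf{M}$, $\mathrm{diag}(\mathbf{M})$ is the vector of its diagonal entries. The maximizer $(\mathbf{\bar x}_\alpha,\mathbf{C}_\alpha)$ of $F_\alpha$ exists and is unique for every $\alpha>0$. The numbers $(a,b)$ are the parameters of a Gamma hyperprior on $\alpha$; the sequence $\{\alpha^k\}$ is the one generated by an EM-type algorithm alternating exact maximization of $F_{\alpha^k}$ in $(\mathbf{\bar x},\mathbf{C})$ with the update of $\alpha$ above.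
   Formalization: The formal theorem additionally assumes m+2(a-1) ≥ 0; this excludes only m=1 with a<1/2, where α² would be negative and F at α², hence its maximizer and the rest of the sequence, is undefined. *)

theory Defs
  imports "HOL-Analysis.Analysis"
begin

definition spd :: "(real ^ 'm ^ 'm) set" where
  "spd = {C. transpose C = C \<and> (\<forall>v. v \<noteq> 0 \<longrightarrow> 0 < v \<bullet> (C *v v))}"

definition exp_vec :: "real ^ 'n \<Rightarrow> real ^ 'n" where
  "exp_vec v = (\<chi> i. exp (v $ i))"

definition ln_vec :: "real ^ 'n \<Rightarrow> real ^ 'n" where
  "ln_vec v = (\<chi> i. ln (v $ i))"

definition fact_vec :: "nat ^ 'n \<Rightarrow> real ^ 'n" where
  "fact_vec y = (\<chi> i. fact (y $ i))"

definition real_vec :: "nat ^ 'n \<Rightarrow> real ^ 'n" where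
  "real_vec y = (\<chi> i. real (y $ i))"

definition diag_vec :: "real ^ 'n ^ 'n \<Rightarrow> real ^ 'n" where
  "diag_vec M = (\<chi> i. M $ i $ i)"

(* The evidence lower bound of the Poisson model with data y, forward matrix A
   and Gaussian prior N(mu0, C0 / alpha), at the Gaussian N(x, C). *)
definition F ::
  "real ^ 'm ^ 'n \<Rightarrow> nat ^ 'n \<Rightarrow> real ^ 'm \<Rightarrow> real ^ 'm ^ 'm \<Rightarrow> real
    \<Rightarrow> real ^ 'm \<Rightarrow> real ^ 'm ^ 'm \<Rightarrow> real" where
  "F A y \<mu>0 C0 \<alpha> x C =
     real_vec y \<bullet> (A *v x)
     - vec 1 \<bullet> exp_vec (A *v x + (1/2) *\<^sub>R diag_vec (A ** C ** transpose A))
     - \<alpha> / 2 * ((x - \<mu>0) \<bullet> (matrix_inv C0 *v (x - \<mu>0)))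
     - \<alpha> / 2 * trace (matrix_inv C0 ** C)
     + 1/2 * ln (det C)
     + real CARD('m) / 2 * ln \<alpha>
     - 1/2 * ln (det C0)
     + real CARD('m) / 2
     - vec 1 \<bullet> ln_vec (fact_vec y)"

(* For alpha > 0 and C0 in spd the maximizer exists and is unique, so the choice made
   by arg_max is immaterial there; for alpha <= 0 the value carries no meaning. *)
definition maximizer ::
  "real ^ 'm ^ 'n \<Rightarrow> nat ^ 'n \<Rightarrow> real ^ 'm \<Rightarrow> real ^ 'm ^ 'm \<Rightarrow> real
    \<Rightarrow> (real ^ 'm) \<times> (real ^ 'm ^ 'm)" where
  "maximizer A y \<mu>0 C0 \<alpha> =
     arg_max (\<lambda>(x, C). F A y \<mu>0 C0 \<alpha> x C) (\<lambda>(x, C). C \<in> spd)"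

definition xbar ::
  "real ^ 'm ^ 'n \<Rightarrow> nat ^ 'n \<Rightarrow> real ^ 'm \<Rightarrow> real ^ 'm ^ 'm \<Rightarrow> real \<Rightarrow> real ^ 'm" where
  "xbar A y \<mu>0 C0 \<alpha> = fst (maximizer A y \<mu>0 C0 \<alpha>)"

definition Cov ::
  "real ^ 'm ^ 'n \<Rightarrow> nat ^ 'n \<Rightarrow> real ^ 'm \<Rightarrow> real ^ 'm ^ 'm \<Rightarrow> real \<Rightarrow> real ^ 'm ^ 'm" where
  "Cov A y \<mu>0 C0 \<alpha> = snd (maximizer A y \<mu>0 C0 \<alpha>)"

definition alpha_update ::
  "real ^ 'm ^ 'n \<Rightarrow> nat ^ 'n \<Rightarrow> real ^ 'm \<Rightarrow> real ^ 'm ^ 'm \<Rightarrow> real \<Rightarrow> real \<Rightarrow> real \<Rightarrow> real" where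
  "alpha_update A y \<mu>0 C0 a b \<alpha> =
     (real CARD('m) + 2 * (a - 1)) /
     ((xbar A y \<mu>0 C0 \<alpha> - \<mu>0) \<bullet> (matrix_inv C0 *v (xbar A y \<mu>0 C0 \<alpha> - \<mu>0))
      + trace (matrix_inv C0 ** Cov A y \<mu>0 C0 \<alpha>) + 2 * b)"

end

(* The maximizer is unique because F is strictly midpoint concave: the Gibbs-type inequality
   ln det C + ln det K <= tr (K C) - m, with equality only for C K = 1, makes ln det strictly
   concave, and it also shows that the superlevel sets of F are compact, so a maximizer exists.
   Let P(alpha) be the quadratic form plus trace that alpha multiplies in F, evaluated at the
   maximizer. Comparing the optimal values for two parameters shows that P is nonincreasing, so
   the update N / (P + 2 b) is a nondecreasing bounded map and its orbits are monotone and
   bounded. At a positive limit the update passes to the limit, because P is continuous there: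
   the maximizers stay in a compact superlevel set and can accumulate only at the unique
   maximizer of the limit problem. *)
theory Submission
  imports Defs
begin

section \<open>Diagonalization of symmetric matrices\<close>

text \<open>This is the first-order condition for a quadratic in \<open>t\<close> that attains its
  minimum 0 at \<open>t = 0\<close>. It is the variational step for eigenvectors and for null
  vectors of semidefinite forms.\<close>

lemma nonneg_quadratic_linear_coeff_zero:
  fixes p q :: real
  assumes "\<And>t. 0 \<le> 2 * t * p + t\<^sup>2 * q"
  shows "p = 0"
proof (rule ccontr)
  assume "p \<noteq> 0"
  \<comment> \<open>The scale is small enough that \<open>s * q - 2 < 0\<close>, so at
    \<open>t = - s * p\<close> the linear term outweighs the quadratic one and the value is
    negative.\<close>
  define s where "s = 1 / (\<bar>q\<bar> + 1)"
  have s: "s > 0" "s * \<bar>q\<bar> < 1" by (auto simp: s_def field_simps)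
  have "2 * (- s * p) * p + (- s * p)\<^sup>2 * q = s * p\<^sup>2 * (s * q - 2)"
    by (simp add: power2_eq_square algebra_simps)
  moreover have "s * q \<le> s * \<bar>q\<bar>" using s by (intro mult_left_mono) auto
  then have "s * q - 2 < 0" using s by linarith
  then have "s * p\<^sup>2 * (s * q - 2) < 0"
    using s \<open>p \<noteq> 0\<close> by (intro mult_pos_neg) auto
  ultimately show False using assms[of "- s * p"] by linarith
qed

text \<open>The form \<open>v \<bullet> f v\<close> attains its maximum on the compact unit sphere
  of \<open>S\<close>, and a maximizer is an eigenvector because its first variation vanishes in
  every direction of \<open>S\<close>.\<close>

lemma self_adjoint_eigenvector_exists:
  fixes f :: "'a::euclidean_space \<Rightarrow> 'a"
  assumes "linear f" and adj: "\<And>x y. x \<bullet> f y = f x \<bullet> y"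
    and S: "subspace S" "f ` S \<subseteq> S" "S \<noteq> {0}"
  shows "\<exists>v\<in>S. norm v = 1 \<and> (\<exists>c. f v = c *\<^sub>R v)"
proof -
  interpret linear f by fact
  let ?U = "S \<inter> sphere 0 1"
  obtain w where w: "w \<in> S" "w \<noteq> 0" using S subspace_0 by blast
  then have "w /\<^sub>R norm w \<in> ?U" using S by (simp add: subspace_scale)
  moreover have "compact ?U" using S by (intro closed_Int_compact closed_subspace) auto
  moreover have "continuous_on ?U (\<lambda>v. v \<bullet> f v)"
    by (intro continuous_intros linear_continuous_on linear_conv_bounded_linear[THEN iffD1] assms)
  ultimately obtain v where v: "v \<in> ?U" "\<And>u. u \<in> ?U \<Longrightarrow> u \<bullet> f u \<le> v \<bullet> f v"
    using continuous_attains_sup[of ?U "\<lambda>v. v \<bullet> f v"] by blast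
  define c where "c = v \<bullet> f v"
  have vv: "v \<bullet> v = 1" using v by (simp add: norm_eq_1)
  have le: "u \<bullet> f u \<le> c * (u \<bullet> u)" if "u \<in> S" for u
  proof (cases "u = 0")
    case False
    have "u /\<^sub>R norm u \<in> ?U" using S that False by (simp add: subspace_scale)
    from v(2)[OF this] have "(u \<bullet> f u) / (norm u)\<^sup>2 \<le> c"
      by (simp add: scale c_def power2_eq_square divide_inverse mult_ac)
    then show ?thesis using False by (simp add: field_simps dot_square_norm)
  qed simp
  \<comment> \<open>On \<open>S\<close> the form
    \<open>c * (w \<bullet> w) - w \<bullet> f w\<close> is nonnegative, and it vanishes at
    \<open>v\<close>; along \<open>v + t *\<^sub>R u\<close> it is therefore a nonnegative quadratic
    in \<open>t\<close> without constant term.\<close>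
  have orth: "(c *\<^sub>R v - f v) \<bullet> u = 0" if "u \<in> S" for u
  proof (rule nonneg_quadratic_linear_coeff_zero)
    fix t
    have "v + t *\<^sub>R u \<in> S" using S v that by (simp add: subspace_add subspace_scale)
    from le[OF this]
    have "(v + t *\<^sub>R u) \<bullet> f (v + t *\<^sub>R u) \<le> c * ((v + t *\<^sub>R u) \<bullet> (v + t *\<^sub>R u))" .
    moreover have "(v + t *\<^sub>R u) \<bullet> f (v + t *\<^sub>R u) = c + 2 * t * (f v \<bullet> u) + t\<^sup>2 * (u \<bullet> f u)"
      using adj[of v u] inner_commute[of u "f v"]
      by (simp add: add scale inner_add_left inner_add_right c_def power2_eq_square algebra_simps)
    moreover have "(v + t *\<^sub>R u) \<bullet> (v + t *\<^sub>R u) = 1 + 2 * t * (v \<bullet> u) + t\<^sup>2 * (u \<bullet> u)"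
      using vv inner_commute[of u v]
      by (simp add: inner_add_left inner_add_right power2_eq_square algebra_simps)
    ultimately have "c + 2 * t * (f v \<bullet> u) + t\<^sup>2 * (u \<bullet> f u) \<le> c * (1 + 2 * t * (v \<bullet> u) + t\<^sup>2 * (u \<bullet> u))"
      by metis
    then show "0 \<le> 2 * t * ((c *\<^sub>R v - f v) \<bullet> u) + t\<^sup>2 * (c * (u \<bullet> u) - u \<bullet> f u)"
      by (simp add: inner_diff_left algebra_simps)
  qed
  \<comment> \<open>By invariance of \<open>S\<close> the residual itself is an admissible
    direction, so it is orthogonal to itself.\<close>
  have "c *\<^sub>R v - f v \<in> S" using S v by (intro subspace_diff subspace_scale) auto
  from orth[OF this] have "f v = c *\<^sub>R v" by simp
  then show ?thesis using v by auto
qed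

text \<open>Induction on the dimension: split off one unit eigenvector; its orthogonal complement in
  \<open>S\<close> is again invariant because \<open>f\<close> is self-adjoint.\<close>

lemma self_adjoint_orthonormal_eigenbasis:
  fixes f :: "'a::euclidean_space \<Rightarrow> 'a"
  assumes "linear f" and adj: "\<And>x y. x \<bullet> f y = f x \<bullet> y"
    and "subspace S" "f ` S \<subseteq> S"
  shows "\<exists>B. pairwise orthogonal B \<and> (\<forall>v\<in>B. norm v = 1 \<and> (\<exists>c. f v = c *\<^sub>R v)) \<and> span B = S"
  using assms(3,4)
proof (induction "dim S" arbitrary: S rule: less_induct)
  case less
  interpret linear f by fact
  show ?case
  proof (cases "S = {0}")
    case True
    then show ?thesis by (intro exI[of _ "{}"]) auto
  next
    case False
    obtain v c where v: "v \<in> S" "norm v = 1" "f v = c *\<^sub>R v"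
      using self_adjoint_eigenvector_exists[OF assms(1,2) less.prems False] by blast
    define T where "T = {x \<in> S. v \<bullet> x = 0}"
    have T: "subspace T"
      using less.prems(1) by (auto simp: T_def subspace_def inner_simps)
    have vv: "v \<bullet> v = 1" using v by (simp add: norm_eq_1)
    have fT: "f ` T \<subseteq> T"
      using less.prems(2) v by (auto simp: T_def adj)
    have "v \<notin> T" using vv by (simp add: T_def)
    moreover have "T \<subseteq> S" by (auto simp: T_def)
    ultimately have "T \<subset> S" using v(1) by blast
    then have "dim T < dim S"
      using T less.prems(1) dim_psubset[of T S] by (simp add: span_eq_iff[THEN iffD2])
    from less.hyps[OF this T fT] obtain B where
      B: "pairwise orthogonal B" "\<forall>v\<in>B. norm v = 1 \<and> (\<exists>c. f v = c *\<^sub>R v)" "span B = T" by blast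
    have BT: "B \<subseteq> T" using B(3) span_superset by blast
    have "span (insert v B) = S"
    proof
      show "span (insert v B) \<subseteq> S"
        using BT v less.prems(1) by (intro span_minimal) (auto simp: T_def)
      show "S \<subseteq> span (insert v B)"
      proof
        fix x assume "x \<in> S"
        then have "x - (v \<bullet> x) *\<^sub>R v \<in> S"
          using v(1) less.prems(1) by (intro subspace_diff subspace_scale)
        then have "x - (v \<bullet> x) *\<^sub>R v \<in> span B"
          unfolding B(3) T_def using vv by (simp add: inner_diff_right)
        then show "x \<in> span (insert v B)" unfolding span_insert by blast
      qed
    qed
    moreover have "pairwise orthogonal (insert v B)"
      using B(1) BT by (auto simp: pairwise_insert T_def orthogonal_def inner_commute)
    ultimately show ?thesis using B(2) v by (intro exI[of _ "insert v B"]) auto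
  qed
qed

definition diag_mat :: "('m \<Rightarrow> real) \<Rightarrow> real ^ 'm ^ 'm" where
  "diag_mat d = (\<chi> i j. if i = j then d i else 0)"

lemma symmetric_matrix_diagonalization:
  fixes M :: "real ^ 'm ^ 'm"
  assumes "transpose M = M"
  obtains Q d where "orthogonal_matrix Q" "M = Q ** diag_mat d ** transpose Q"
proof -
  have "x \<bullet> (M *v y) = (M *v x) \<bullet> y" for x y
    by (metis assms dot_lmul_matrix vector_transpose_matrix)
  from self_adjoint_orthonormal_eigenbasis[OF _ this subspace_UNIV]
  obtain B where B: "pairwise orthogonal B" "span B = UNIV"
    "\<And>v. v \<in> B \<Longrightarrow> norm v = 1" "\<And>v. v \<in> B \<Longrightarrow> \<exists>c. M *v v = c *\<^sub>R v" by auto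
  have "independent B"
    using B by (intro pairwise_orthogonal_independent) (auto, force)
  then have "card B = CARD('m)" "finite B"
    using B(2) independent_imp_finite by (metis dim_UNIV dim_span_eq_card_independent DIM_cart DIM_real mult.right_neutral, blast)
  \<comment> \<open>The eigenbasis has exactly \<open>CARD('m)\<close> elements, so it can be
    indexed by \<open>'m\<close> and supply the columns of \<open>Q\<close>.\<close>
  then obtain e where e: "bij_betw e (UNIV :: 'm set) B"
    using finite_same_card_bij[of "UNIV :: 'm set" B] by auto
  then have eB: "e i \<in> B" for i by (auto simp: bij_betw_def)
  have ee: "e i \<bullet> e j = (if i = j then 1 else 0)" for i j
  proof (cases "i = j")
    case True
    then show ?thesis using B(3)[OF eB] by (simp add: norm_eq_1)
  next
    case False
    then have "e i \<noteq> e j" using e by (auto simp: bij_betw_def inj_on_def)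
    then show ?thesis using False B(1) eB by (auto simp: pairwise_def orthogonal_def)
  qed
  obtain d where d: "\<And>i. M *v e i = d i *\<^sub>R e i" using B(4)[OF eB] by metis
  define Q where "Q = (\<chi> i j. e j $ i)"
  have 1: "transpose Q ** Q = mat 1"
    using ee by (auto simp: vec_eq_iff matrix_matrix_mult_def transpose_def Q_def mat_def inner_vec_def)
  then have Q: "orthogonal_matrix Q" by (simp add: orthogonal_matrix)
  have "M ** Q = Q ** diag_mat d"
  proof -
    have "(M *v e j) $ i = (d j *\<^sub>R e j) $ i" for i j using d by simp
    then show ?thesis
      by (auto simp: vec_eq_iff matrix_matrix_mult_def matrix_vector_mult_def Q_def diag_mat_def
          if_distrib[of "\<lambda>x. _ * x"] cong: if_cong)
  qed
  then have "M = Q ** diag_mat d ** transpose Q"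
    by (metis Q matrix_mul_assoc matrix_mul_rid orthogonal_matrix_def)
  with Q that show ?thesis by blast
qed

lemma det_diag_mat: "det (diag_mat d) = prod d UNIV"
  by (simp add: diag_mat_def det_diagonal)

lemma trace_diag_mat: "trace (diag_mat d) = sum d UNIV"
  by (simp add: diag_mat_def trace_def)

lemma diag_mat_mult: "diag_mat d ** diag_mat e = diag_mat (\<lambda>i. d i * e i)"
  by (auto simp: vec_eq_iff matrix_matrix_mult_def diag_mat_def if_distrib[of "\<lambda>x. x * _"] cong: if_cong)

lemma transpose_diag_mat: "transpose (diag_mat d) = diag_mat d"
  by (auto simp: transpose_def diag_mat_def vec_eq_iff)

lemma det_orthogonal_conj:
  fixes M Q :: "real ^ 'm ^ 'm"
  assumes "orthogonal_matrix Q" shows "det (Q ** M ** transpose Q) = det M"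
proof -
  have "det Q * det Q = 1"
    using assms by (metis det_I det_mul det_transpose orthogonal_matrix_def)
  then show ?thesis by (simp add: det_mul mult_ac)
qed

lemma trace_orthogonal_conj:
  fixes M Q :: "real ^ 'm ^ 'm"
  assumes "orthogonal_matrix Q" shows "trace (Q ** M ** transpose Q) = trace M"
  using assms by (metis matrix_mul_assoc matrix_mul_rid orthogonal_matrix_def trace_mul_sym)

lemma inner_congruence:
  fixes M :: "real ^ 'm ^ 'm" and Q :: "real ^ 'n ^ 'm"
  shows "v \<bullet> ((transpose Q ** M ** Q) *v v) = (Q *v v) \<bullet> (M *v (Q *v v))"
proof -
  have "v \<bullet> ((transpose Q ** M ** Q) *v v) = v \<bullet> (transpose Q *v (M *v (Q *v v)))"
    by (simp add: matrix_vector_mul_assoc matrix_mul_assoc del: transpose_matrix_vector)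
  also have "\<dots> = (Q *v v) \<bullet> (M *v (Q *v v))"
    by (subst dot_lmul_matrix[symmetric]) (simp only: vector_transpose_matrix)
  finally show ?thesis .
qed

lemma diag_entry_inner: "M $ i $ i = axis i 1 \<bullet> (M *v axis i (1::real))"
  by (simp add: inner_axis' matrix_vector_mul_component inner_axis)

section \<open>Positive definite matrices\<close>

lemma spd_imp_sym: "C \<in> spd \<Longrightarrow> transpose C = C"
  and spd_imp_pos: "C \<in> spd \<Longrightarrow> v \<noteq> 0 \<Longrightarrow> 0 < v \<bullet> (C *v v)"
  by (auto simp: spd_def)

lemma spd_imp_nonneg: "C \<in> spd \<Longrightarrow> 0 \<le> v \<bullet> (C *v v)"
  by (cases "v = 0") (auto simp: spd_def less_imp_le)

lemma invertible_mult_nonzero: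
  fixes L :: "real ^ 'm ^ 'm"
  assumes "invertible L" "v \<noteq> 0" shows "L *v v \<noteq> 0"
proof
  assume "L *v v = 0"
  obtain M where "M ** L = mat 1" using assms(1) unfolding invertible_def by blast
  then have "v = M *v (L *v v)" by (simp add: matrix_vector_mul_assoc)
  with \<open>L *v v = 0\<close> assms(2) show False by simp
qed

text \<open>Each eigenvalue \<open>d i\<close> is the quadratic form of \<open>M\<close> at the
  column \<open>i\<close> of \<open>Q\<close>, which is nonzero since \<open>Q\<close> is
  invertible.\<close>

lemma spd_diagonalization:
  fixes M :: "real ^ 'm ^ 'm"
  assumes "M \<in> spd"
  obtains Q d where "orthogonal_matrix Q" "M = Q ** diag_mat d ** transpose Q" "\<And>i. d i > 0"
proof -
  obtain Q d where Q: "orthogonal_matrix Q" and M: "M = Q ** diag_mat d ** transpose Q"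
    using symmetric_matrix_diagonalization assms spd_imp_sym by metis
  have "d i > 0" for i
  proof -
    have D: "diag_mat d = transpose Q ** M ** Q"
      unfolding M using Q by (metis matrix_mul_assoc matrix_mul_lid matrix_mul_rid orthogonal_matrix_def)
    have "d i = axis i 1 \<bullet> (diag_mat d *v axis i 1)"
      by (simp flip: diag_entry_inner) (simp add: diag_mat_def)
    also have "\<dots> > 0" unfolding D inner_congruence
      using Q by (intro spd_imp_pos assms invertible_mult_nonzero)
        (auto simp: axis_eq_0_iff orthogonal_matrix_def invertible_def)
    finally show ?thesis .
  qed
  with Q M that show ?thesis by blast
qed

lemma spd_det_pos: "0 < det C" if "C \<in> spd" for C :: "real ^ 'm ^ 'm"
  using spd_diagonalization[OF that] by (metis det_diag_mat det_orthogonal_conj prod_pos)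

lemma spd_invertible: "C \<in> spd \<Longrightarrow> invertible C"
  using spd_det_pos invertible_det_nz by (metis less_irrefl)

lemma spd_congruence:
  fixes M L :: "real ^ 'm ^ 'm"
  assumes "M \<in> spd" "invertible L" shows "transpose L ** M ** L \<in> spd"
proof -
  have "transpose (transpose L ** M ** L) = transpose L ** M ** L"
    using spd_imp_sym[OF assms(1)] by (simp add: matrix_transpose_mul matrix_mul_assoc)
  moreover have "L *v v \<noteq> 0" if "v \<noteq> 0" for v
    using that assms(2) by (rule invertible_mult_nonzero[rotated])
  ultimately show ?thesis using assms(1) by (simp add: spd_def inner_congruence)
qed

text \<open>Take square roots of the eigenvalues. The root serves to replace \<open>K ** C\<close>,
  which need not be symmetric, by the positive definite \<open>L ** C ** L\<close> with the same
  trace and determinant.\<close>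

lemma spd_sqrt:
  fixes K :: "real ^ 'm ^ 'm"
  assumes "K \<in> spd"
  obtains L where "transpose L = L" "invertible L" "L ** L = K"
proof -
  obtain Q d where Q: "orthogonal_matrix Q" and K: "K = Q ** diag_mat d ** transpose Q" and d: "\<And>i. d i > 0"
    using spd_diagonalization[OF assms] by metis
  define L where "L = Q ** diag_mat (\<lambda>i. sqrt (d i)) ** transpose Q"
  have "L ** L = Q ** (diag_mat (\<lambda>i. sqrt (d i)) ** (transpose Q ** Q) ** diag_mat (\<lambda>i. sqrt (d i))) ** transpose Q"
    by (simp add: L_def matrix_mul_assoc)
  also have "\<dots> = Q ** diag_mat (\<lambda>i. sqrt (d i) * sqrt (d i)) ** transpose Q"
    using Q by (simp add: orthogonal_matrix diag_mat_mult)
  also have "\<dots> = K" using d by (simp add: K less_imp_le)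
  finally have LL: "L ** L = K" .
  moreover have "transpose L = L"
    by (simp add: L_def matrix_transpose_mul transpose_diag_mat matrix_mul_assoc)
  moreover have "invertible L"
    using LL spd_det_pos[OF assms] invertible_det_nz by (metis det_mul less_irrefl mult_zero_left)
  ultimately show ?thesis using that by blast
qed

section \<open>Gibbs-type inequality and strict concavity of the log-determinant\<close>

lemma spd_ln_det_le_trace:
  fixes S :: "real ^ 'm ^ 'm"
  assumes "S \<in> spd"
  shows "ln (det S) \<le> trace S - real CARD('m)"
    and "ln (det S) = trace S - real CARD('m) \<Longrightarrow> S = mat 1"
proof -
  obtain Q d where Q: "orthogonal_matrix Q" and S: "S = Q ** diag_mat d ** transpose Q" and d: "\<And>i. d i > 0"
    using spd_diagonalization[OF assms] by metis
  have lndet: "ln (det S) = (\<Sum>i\<in>UNIV. ln (d i))"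
    unfolding S det_orthogonal_conj[OF Q] det_diag_mat using d by (intro ln_prod) (auto simp: less_imp_neq[symmetric])
  have tr: "trace S - real CARD('m) = (\<Sum>i\<in>UNIV. d i - 1)"
    unfolding S trace_orthogonal_conj[OF Q] trace_diag_mat by (simp add: sum_subtractf)
  \<comment> \<open>Both claims reduce to this inequality for single eigenvalues: equality of the
    sums forces equality in each term, hence every eigenvalue is 1.\<close>
  have le: "ln (d i) \<le> d i - 1" for i using ln_le_minus_one[OF d] .
  show "ln (det S) \<le> trace S - real CARD('m)"
    unfolding lndet tr by (intro sum_mono le)
  assume "ln (det S) = trace S - real CARD('m)"
  then have "ln (d i) = d i - 1" for i
    unfolding lndet tr by (rule sum_mono_inv) (use le in auto)
  then have "d = (\<lambda>i. 1)" using d ln_eq_minus_one by blast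
  then have "diag_mat d = mat 1" by (simp add: diag_mat_def mat_def)
  then show "S = mat 1" using S Q by (simp add: orthogonal_matrix_def)
qed

text \<open>Apply the bound for one matrix to \<open>S = L ** C ** L\<close> with \<open>L\<close>
  the square root of \<open>K\<close>. If \<open>S\<close> is the identity, then \<open>L\<close>
  and \<open>C ** L\<close> are inverse to each other on both sides, which turns into
  \<open>C ** K = mat 1\<close>.\<close>

lemma spd_ln_det_add_le_trace:
  fixes C K :: "real ^ 'm ^ 'm"
  assumes C: "C \<in> spd" and K: "K \<in> spd"
  shows "ln (det C) + ln (det K) \<le> trace (K ** C) - real CARD('m)"
    and "ln (det C) + ln (det K) = trace (K ** C) - real CARD('m) \<Longrightarrow> C ** K = mat 1"
proof -
  obtain L where L: "transpose L = L" "invertible L" "L ** L = K" using spd_sqrt[OF K] by metis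
  define S where "S = L ** C ** L"
  have S: "S \<in> spd" using spd_congruence[OF C L(2)] L(1) by (simp add: S_def)
  have "det S = det C * det K" unfolding S_def L(3)[symmetric] by (simp add: det_mul)
  then have ln: "ln (det S) = ln (det C) + ln (det K)"
    using spd_det_pos[OF C] spd_det_pos[OF K] by (simp add: ln_mult)
  have tr: "trace S = trace (K ** C)"
    unfolding S_def L(3)[symmetric] using trace_mul_sym[of "L ** C" L] by (simp add: matrix_mul_assoc)
  show "ln (det C) + ln (det K) \<le> trace (K ** C) - real CARD('m)"
    using spd_ln_det_le_trace(1)[OF S] ln tr by simp
  assume "ln (det C) + ln (det K) = trace (K ** C) - real CARD('m)"
  then have "S = mat 1" using spd_ln_det_le_trace(2)[OF S] ln tr by simp
  then have "L ** (C ** L) = mat 1" by (simp add: S_def matrix_mul_assoc)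
  then have "(C ** L) ** L = mat 1" using matrix_left_right_inverse by blast
  then show "C ** K = mat 1" by (simp add: L(3)[symmetric] matrix_mul_assoc)
qed

lemma spd_scaleR:
  assumes "C \<in> spd" "0 < t" shows "t *\<^sub>R C \<in> spd"
proof -
  have "(t *\<^sub>R C) *v v = t *\<^sub>R (C *v v)" for v
    by (simp add: scaleR_matrix_vector_assoc)
  moreover have "transpose (t *\<^sub>R C) = t *\<^sub>R transpose C"
    by (simp add: transpose_def vec_eq_iff)
  ultimately show ?thesis using assms by (simp add: spd_def)
qed

lemma spd_add:
  assumes "C \<in> spd" "D \<in> spd" shows "C + D \<in> spd"
proof -
  have "transpose (C + D) = transpose C + transpose D"
    by (simp add: transpose_def vec_eq_iff)
  then show ?thesis using assms
    by (simp add: spd_def matrix_vector_mult_add_rdistrib inner_add_right add_pos_pos)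
qed

lemma matrix_inv_works:
  assumes "invertible C"
  shows "C ** matrix_inv C = mat 1" and "matrix_inv C ** C = mat 1"
  using someI_ex[OF assms[unfolded invertible_def]] by (auto simp: matrix_inv_def)

text \<open>The inverse \<open>I\<close> is a congruence of \<open>C\<close> itself:
  \<open>I = transpose I ** C ** I\<close>.\<close>

lemma spd_matrix_inv:
  fixes C :: "real ^ 'm ^ 'm"
  assumes "C \<in> spd" shows "matrix_inv C \<in> spd"
proof -
  define I where "I = matrix_inv C"
  have CI: "C ** I = mat 1" "I ** C = mat 1"
    unfolding I_def using spd_invertible[OF assms] by (rule matrix_inv_works)+
  have "transpose I ** C = mat 1"
    using CI(1) spd_imp_sym[OF assms] by (metis matrix_transpose_mul transpose_mat)
  then have "transpose I ** C ** I = I" by simp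
  moreover have "invertible I" using CI invertible_def by blast
  ultimately show ?thesis
    using spd_congruence[OF assms, of I] by (simp add: I_def)
qed

text \<open>With \<open>K\<close> the inverse of the midpoint \<open>M\<close>, the Gibbs-type
  inequality says that \<open>ln det\<close> lies below its tangent at \<open>M\<close>. Adding it
  for \<open>C\<close> and \<open>D\<close> cancels the traces, since those of \<open>K ** C\<close>
  and \<open>K ** D\<close> sum to \<open>2 * CARD('m)\<close>. Equality forces
  \<open>C ** K\<close> and \<open>D ** K\<close> both to be the identity.\<close>

lemma spd_ln_det_midpoint:
  fixes C D :: "real ^ 'm ^ 'm"
  assumes C: "C \<in> spd" and D: "D \<in> spd"
  shows "(ln (det C) + ln (det D)) / 2 \<le> ln (det ((1/2) *\<^sub>R (C + D)))"
    and "(ln (det C) + ln (det D)) / 2 = ln (det ((1/2) *\<^sub>R (C + D))) \<Longrightarrow> C = D"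
proof -
  define M where "M = (1/2) *\<^sub>R (C + D)"
  have M: "M \<in> spd" unfolding M_def by (intro spd_scaleR spd_add C D) simp
  define K where "K = matrix_inv M"
  have K: "K \<in> spd" unfolding K_def by (rule spd_matrix_inv[OF M])
  have KM: "K ** M = mat 1" "M ** K = mat 1"
    unfolding K_def using spd_invertible[OF M] by (rule matrix_inv_works)+
  have "det K * det M = 1" using KM by (metis det_I det_mul)
  then have ln: "ln (det K) = - ln (det M)"
    using spd_det_pos[OF K] spd_det_pos[OF M] ln_mult[of "det K" "det M"] by auto
  have "C + D = M + M" by (simp add: M_def flip: scaleR_2)
  then have "K ** (C + D) = K ** (M + M)" by (rule arg_cong)
  then have "K ** C + K ** D = mat 1 + mat 1"
    by (simp only: matrix_add_ldistrib KM)
  from arg_cong[OF this, of trace] have tr: "trace (K ** C) + trace (K ** D) = 2 * real CARD('m)"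
    by (simp only: trace_add trace_I mult_2)
  note le = spd_ln_det_add_le_trace(1)[OF C K] spd_ln_det_add_le_trace(1)[OF D K]
  show "(ln (det C) + ln (det D)) / 2 \<le> ln (det ((1/2) *\<^sub>R (C + D)))"
    using le tr ln unfolding M_def[symmetric] by simp
  assume "(ln (det C) + ln (det D)) / 2 = ln (det ((1/2) *\<^sub>R (C + D)))"
  then have "ln (det C) + ln (det D) = 2 * ln (det M)" unfolding M_def[symmetric] by simp
  then have "ln (det C) + ln (det K) = trace (K ** C) - real CARD('m)"
    and "ln (det D) + ln (det K) = trace (K ** D) - real CARD('m)"
    using le tr ln by simp_all
  then have "C ** K = D ** K"
    using spd_ln_det_add_le_trace(2)[OF C K] spd_ln_det_add_le_trace(2)[OF D K] by simp
  then show "C = D" by (metis KM(1) matrix_mul_assoc matrix_mul_rid)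
qed

section \<open>Trace, form and norm bounds for semidefinite matrices\<close>

lemma psd_congruence_diag_nonneg:
  fixes C :: "real ^ 'm ^ 'm" and Q :: "real ^ 'n ^ 'm"
  assumes "\<And>v. 0 \<le> v \<bullet> (C *v v)"
  shows "0 \<le> (transpose Q ** C ** Q) $ i $ i"
  unfolding diag_entry_inner inner_congruence by (rule assms)

text \<open>In an eigenbasis of \<open>K\<close> the trace of \<open>K ** C\<close> is a sum of
  nonnegative diagonal entries weighted by the eigenvalues, and \<open>l\<close> is the least
  eigenvalue.\<close>

lemma trace_mult_lower_bound:
  fixes K :: "real ^ 'm ^ 'm"
  assumes "K \<in> spd"
  obtains l where "l > 0"
    and "\<And>C. (\<And>v. 0 \<le> v \<bullet> (C *v v)) \<Longrightarrow> l * trace C \<le> trace (K ** C)"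
proof -
  obtain Q d where Q: "orthogonal_matrix Q" and K: "K = Q ** diag_mat d ** transpose Q" and d: "\<And>i. d i > 0"
    using spd_diagonalization[OF assms] by metis
  define l where "l = Min (range d)"
  have l: "l > 0" "l \<le> d i" for i using d by (auto simp: l_def)
  have "l * trace C \<le> trace (K ** C)" if C: "\<And>v. 0 \<le> v \<bullet> (C *v v)" for C
  proof -
    define E where "E = transpose Q ** C ** Q"
    have "trace (K ** C) = trace (Q ** (diag_mat d ** transpose Q ** C))"
      by (simp add: K matrix_mul_assoc)
    also have "\<dots> = trace (diag_mat d ** E)"
      by (subst trace_mul_sym) (simp add: E_def matrix_mul_assoc)
    also have "\<dots> = (\<Sum>i\<in>UNIV. d i * E $ i $ i)"
      by (simp add: trace_def matrix_matrix_mult_def diag_mat_def if_distrib[of "\<lambda>x. x * _"] cong: if_cong)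
    finally have 1: "trace (K ** C) = (\<Sum>i\<in>UNIV. d i * E $ i $ i)" .
    have "trace E = trace C"
      using trace_orthogonal_conj[of "transpose Q" C] Q by (simp add: E_def)
    then have "l * trace C = (\<Sum>i\<in>UNIV. l * E $ i $ i)"
      by (metis sum_distrib_left trace_def)
    also have "\<dots> \<le> (\<Sum>i\<in>UNIV. d i * E $ i $ i)"
      unfolding E_def by (intro sum_mono mult_right_mono l psd_congruence_diag_nonneg C)
    finally show ?thesis using 1 by simp
  qed
  with l that show ?thesis by blast
qed

text \<open>The trace bound is applied to the rank-one matrix \<open>V\<close> with entries
  \<open>v $ i * v $ j\<close>.\<close>

lemma spd_quadratic_form_lower_bound:
  fixes K :: "real ^ 'm ^ 'm"
  assumes "K \<in> spd"
  obtains l where "l > 0" "\<And>v. l * (norm v)\<^sup>2 \<le> v \<bullet> (K *v v)"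
proof -
  obtain l where l: "l > 0"
    and le: "\<And>C. (\<And>v. 0 \<le> v \<bullet> (C *v v)) \<Longrightarrow> l * trace C \<le> trace (K ** C)"
    using trace_mult_lower_bound[OF assms] by metis
  have "l * (norm v)\<^sup>2 \<le> v \<bullet> (K *v v)" for v
  proof -
    define V where "V = (\<chi> i j. v $ i * v $ j)"
    have "V *v w = (v \<bullet> w) *\<^sub>R v" for w
      by (simp add: V_def vec_eq_iff matrix_vector_mult_def inner_vec_def sum_distrib_left mult_ac)
    then have "0 \<le> w \<bullet> (V *v w)" for w by (simp add: inner_commute)
    from le[OF this] have "l * trace V \<le> trace (K ** V)" .
    moreover have "trace V = (norm v)\<^sup>2"
      by (simp add: power2_norm_eq_inner inner_vec_def trace_def V_def)
    moreover have "trace (K ** V) = v \<bullet> (K *v v)"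
      by (simp add: trace_def matrix_matrix_mult_def V_def inner_vec_def matrix_vector_mult_def
          sum_distrib_left mult_ac)
    ultimately show ?thesis by simp
  qed
  with l that show ?thesis by blast
qed

lemma quadratic_form_add:
  fixes C :: "real ^ 'm ^ 'm"
  assumes "transpose C = C"
  shows "(v + t *\<^sub>R w) \<bullet> (C *v (v + t *\<^sub>R w))
    = v \<bullet> (C *v v) + 2 * t * ((C *v v) \<bullet> w) + t\<^sup>2 * (w \<bullet> (C *v w))"
proof -
  have "v \<bullet> (C *v w) = (C *v v) \<bullet> w"
    by (metis assms dot_lmul_matrix vector_transpose_matrix)
  then show ?thesis
    by (simp add: matrix_vector_right_distrib matrix_vector_mult_scaleR inner_add_left inner_add_right
        inner_commute[of w "C *v v"] power2_eq_square algebra_simps)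
qed

text \<open>A null vector of a semidefinite form minimizes it, so its first variation vanishes and
  it lies in the kernel of \<open>C\<close>. This lets closed conditions, semidefiniteness and a
  positive lower bound on the determinant, cut out sets inside \<open>spd\<close>.\<close>

lemma psd_det_nonzero_imp_spd:
  fixes C :: "real ^ 'm ^ 'm"
  assumes sym: "transpose C = C" and psd: "\<And>v. 0 \<le> v \<bullet> (C *v v)" and "det C \<noteq> 0"
  shows "C \<in> spd"
proof -
  have "v \<bullet> (C *v v) \<noteq> 0" if "v \<noteq> 0" for v
  proof
    assume 0: "v \<bullet> (C *v v) = 0"
    have "(C *v v) \<bullet> w = 0" for w
    proof (rule nonneg_quadratic_linear_coeff_zero)
      show "0 \<le> 2 * t * ((C *v v) \<bullet> w) + t\<^sup>2 * (w \<bullet> (C *v w))" for t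
        using psd[of "v + t *\<^sub>R w"] 0 by (simp add: quadratic_form_add[OF sym])
    qed
    then have "C *v v = 0" by (metis inner_eq_zero_iff)
    then show False
      using invertible_mult_nonzero[of C v] that assms(3) by (simp add: invertible_det_nz)
  qed
  then show ?thesis using sym psd by (auto simp: spd_def less_le)
qed

lemma psd_trace_nonneg:
  fixes C :: "real ^ 'm ^ 'm"
  assumes "\<And>v. 0 \<le> v \<bullet> (C *v v)" shows "0 \<le> trace C"
  unfolding trace_def diag_entry_inner by (intro sum_nonneg assms)

lemma psd_norm_le_trace:
  fixes C :: "real ^ 'm ^ 'm"
  assumes sym: "transpose C = C" and psd: "\<And>v. 0 \<le> v \<bullet> (C *v v)"
  shows "norm C \<le> (real CARD('m))\<^sup>2 * trace C"
proof -
  have diag: "0 \<le> C $ i $ i" for i unfolding diag_entry_inner by (rule psd)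
  have "C $ i $ i \<le> trace C" for i
    unfolding trace_def using diag by (intro member_le_sum) auto
  note tr = this
  have entry: "\<bar>C $ i $ j\<bar> \<le> trace C" for i j
  proof -
    have "(C *v axis i 1) \<bullet> axis j 1 = C $ i $ j"
      using arg_cong[OF sym, of "\<lambda>M. M $ i $ j"]
      by (simp add: inner_axis matrix_vector_mul_component transpose_def)
    then have "0 \<le> C $ i $ i + 2 * t * C $ i $ j + t\<^sup>2 * C $ j $ j" for t
      using psd[of "axis i 1 + t *\<^sub>R axis j 1"] unfolding quadratic_form_add[OF sym]
      by (simp flip: diag_entry_inner)
    \<comment> \<open>The two signs of \<open>t\<close> bound an off-diagonal entry by the mean of
      two diagonal entries, and each of these is at most the trace.\<close>
    from this[of 1] this[of "-1"] tr[of i] tr[of j] show ?thesis by simp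
  qed
  have "norm C \<le> (\<Sum>i\<in>UNIV. norm (C $ i))"
    unfolding norm_vec_def by (rule L2_set_le_sum) simp
  also have "\<dots> \<le> (\<Sum>i\<in>(UNIV::'m set). \<Sum>j\<in>(UNIV::'m set). trace C)"
    by (intro sum_mono order_trans[OF norm_le_l1_cart] entry)
  finally show ?thesis by (simp add: power2_eq_square)
qed

section \<open>Concavity and coercivity of the lower bound\<close>

definition penalty :: "real ^ 'm \<Rightarrow> real ^ 'm ^ 'm \<Rightarrow> real ^ 'm \<Rightarrow> real ^ 'm ^ 'm \<Rightarrow> real" where
  "penalty \<mu>0 C0 x C = (x - \<mu>0) \<bullet> (matrix_inv C0 *v (x - \<mu>0)) + trace (matrix_inv C0 ** C)"

text \<open>A change of \<alpha> shifts \<open>F\<close> by a multiple of the penalty and by a term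
  independent of \<open>x\<close> and \<open>C\<close>, so problems for different parameters are
  compared through the penalty alone.\<close>

lemma F_change_alpha:
  fixes \<mu>0 :: "real ^ 'm"
  shows "F A y \<mu>0 C0 \<alpha> x C = F A y \<mu>0 C0 \<beta> x C - (\<alpha> - \<beta>) / 2 * penalty \<mu>0 C0 x C
     + real CARD('m) / 2 * (ln \<alpha> - ln \<beta>)"
  by (simp add: F_def penalty_def field_simps)

text \<open>This is the logarithm of the expectation of \<open>exp ((A *v X) $ i)\<close> for a
  Gaussian \<open>X\<close> with mean \<open>x\<close> and covariance \<open>C\<close>. It is linear
  in the pair \<open>(x, C)\<close>.\<close>

definition log_mean :: "real ^ 'm ^ 'n \<Rightarrow> 'n \<Rightarrow> real ^ 'm \<Rightarrow> real ^ 'm ^ 'm \<Rightarrow> real" where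
  "log_mean A i x C = (A *v x) $ i + 1/2 * (A ** C ** transpose A) $ i $ i"

lemma vec1_inner_exp_vec:
  "vec 1 \<bullet> exp_vec (A *v x + (1/2) *\<^sub>R diag_vec (A ** C ** transpose A)) = (\<Sum>i\<in>UNIV. exp (log_mean A i x C))"
  by (simp add: inner_vec_def exp_vec_def diag_vec_def log_mean_def)

lemma log_mean_add: "log_mean A i (x + z) (C + D) = log_mean A i x C + log_mean A i z D"
proof -
  have "A ** (C + D) ** transpose A = A ** C ** transpose A + A ** D ** transpose A"
    by (simp add: matrix_add_ldistrib) (simp add: matrix_matrix_mult_def vec_eq_iff sum.distrib distrib_right)
  then show ?thesis by (simp add: log_mean_def matrix_vector_right_distrib)
qed

lemma log_mean_scaleR: "log_mean A i (t *\<^sub>R x) (t *\<^sub>R C) = t * log_mean A i x C"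
  by (simp add: log_mean_def matrix_vector_mult_def matrix_matrix_mult_def sum_distrib_left
      distrib_left mult_ac)

lemma continuous_on_det [continuous_intros]:
  fixes f :: "'a::topological_space \<Rightarrow> real ^ 'm ^ 'm"
  assumes "continuous_on S f" shows "continuous_on S (\<lambda>x. det (f x))"
  unfolding det_def by (intro continuous_intros assms)

lemma continuous_on_F:
  fixes A :: "real ^ 'm ^ 'n"
  shows "continuous_on (UNIV \<times> spd) (\<lambda>z. F A y \<mu>0 C0 \<alpha> (fst z) (snd z))"
  unfolding F_def vec1_inner_exp_vec
  unfolding log_mean_def inner_vec_def trace_def matrix_vector_mult_def matrix_matrix_mult_def
  by (simp, intro continuous_intros) (auto dest: spd_det_pos)

lemma continuous_on_penalty:
  "continuous_on UNIV (\<lambda>z. penalty \<mu>0 C0 (fst z) (snd z))"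
  unfolding penalty_def inner_vec_def trace_def matrix_vector_mult_def matrix_matrix_mult_def
  by (simp, intro continuous_intros)

text \<open>For nonnegative \<open>s\<close> the exponential dominates \<open>s\<^sup>2 / 2\<close>
  and Young's inequality applies; for negative \<open>s\<close> the left side is
  nonpositive.\<close>

lemma mult_le_exp_plus_square:
  fixes s y :: real assumes "0 \<le> y" shows "y * s \<le> exp s + y\<^sup>2 / 2"
proof (cases "0 \<le> s")
  case True
  have "0 \<le> (y - s)\<^sup>2" by simp
  then have "y * s \<le> s\<^sup>2 / 2 + y\<^sup>2 / 2" by (simp add: power2_diff)
  also have "s\<^sup>2 / 2 \<le> exp s" using exp_lower_Taylor_quadratic[OF True] True by simp
  finally show ?thesis by simp
next
  case False
  then have "y * s \<le> 0" using assms by (simp add: mult_nonneg_nonpos)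
  then show ?thesis by (smt (verit) exp_gt_zero zero_le_power2 divide_nonneg_pos)
qed

lemma F_upper_bound:
  fixes A :: "real ^ 'm ^ 'n" and \<mu>0 :: "real ^ 'm"
  obtains B where "\<And>x C. C \<in> spd \<Longrightarrow>
    F A y \<mu>0 C0 \<alpha> x C \<le> B + ln (det C) / 2 - \<alpha> / 2 * penalty \<mu>0 C0 x C"
proof
  fix x :: "real ^ 'm" and C :: "real ^ 'm ^ 'm" assume C: "C \<in> spd"
  have "real_vec y \<bullet> (A *v x) - (\<Sum>i\<in>UNIV. exp (log_mean A i x C)) \<le> (\<Sum>i\<in>UNIV. (real (y $ i))\<^sup>2 / 2)"
  proof -
    have "real (y $ i) * (A *v x) $ i \<le> exp (log_mean A i x C) + (real (y $ i))\<^sup>2 / 2" for i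
    proof -
      have "0 \<le> (A ** C ** transpose A) $ i $ i"
        using psd_congruence_diag_nonneg[of C "transpose A"] spd_imp_nonneg[OF C] by simp
      then have "exp ((A *v x) $ i) \<le> exp (log_mean A i x C)" by (simp add: log_mean_def)
      then show ?thesis using mult_le_exp_plus_square[of "real (y $ i)" "(A *v x) $ i"] by linarith
    qed
    then have "(\<Sum>i\<in>UNIV. real (y $ i) * (A *v x) $ i)
        \<le> (\<Sum>i\<in>UNIV. exp (log_mean A i x C) + (real (y $ i))\<^sup>2 / 2)" by (rule sum_mono)
    then show ?thesis by (simp add: inner_vec_def real_vec_def sum.distrib)
  qed
  then show "F A y \<mu>0 C0 \<alpha> x C \<le> ((\<Sum>i\<in>UNIV. (real (y $ i))\<^sup>2 / 2)
      + real CARD('m) / 2 * ln \<alpha> - 1/2 * ln (det C0) + real CARD('m) / 2 - vec 1 \<bullet> ln_vec (fact_vec y))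
     + ln (det C) / 2 - \<alpha> / 2 * penalty \<mu>0 C0 x C"
    unfolding F_def vec1_inner_exp_vec penalty_def by (simp add: algebra_simps)
qed

section \<open>Compact sets of semidefinite matrices\<close>

lemma closed_psd: "closed {C :: real ^ 'm ^ 'm. transpose C = C \<and> (\<forall>v. 0 \<le> v \<bullet> (C *v v))}"
proof -
  have "closed {C :: real ^ 'm ^ 'm. C $ i $ j = C $ j $ i}" for i j
    by (intro closed_Collect_eq continuous_intros)
  moreover have "closed {C :: real ^ 'm ^ 'm. 0 \<le> v \<bullet> (C *v v)}" for v
    unfolding inner_vec_def matrix_vector_mult_def
    by (simp, intro closed_Collect_le continuous_intros)
  moreover have "{C :: real ^ 'm ^ 'm. transpose C = C \<and> (\<forall>v. 0 \<le> v \<bullet> (C *v v))}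
    = (\<Inter>i. \<Inter>j. {C. C $ i $ j = C $ j $ i}) \<inter> (\<Inter>v. {C. 0 \<le> v \<bullet> (C *v v)})"
    by (auto simp: transpose_def vec_eq_iff)
  ultimately show ?thesis by (simp add: closed_Int closed_INT)
qed

text \<open>The trace controls the norm of a semidefinite matrix, and all conditions are closed. For
  positive \<open>e\<close> the set stays away from the singular matrices, where
  \<open>ln det\<close> is unbounded below.\<close>

lemma compact_psd_trace_det:
  fixes e r :: real
  shows "compact {C :: real ^ 'm ^ 'm. transpose C = C \<and> (\<forall>v. 0 \<le> v \<bullet> (C *v v)) \<and> trace C \<le> r \<and> e \<le> det C}"
    (is "compact ?S")
proof -
  have "norm C \<le> (real CARD('m))\<^sup>2 * r" if "C \<in> ?S" for C
    using psd_norm_le_trace[of C] that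
    by (smt (verit, ccfv_threshold) mem_Collect_eq mult_left_mono zero_le_power2)
  then have "bounded ?S" by (auto simp: bounded_iff)
  moreover have "closed {C :: real ^ 'm ^ 'm. trace C \<le> r}"
    unfolding trace_def by (intro closed_Collect_le continuous_intros)
  moreover have "closed {C :: real ^ 'm ^ 'm. e \<le> det C}"
    by (intro closed_Collect_le continuous_intros)
  moreover have "?S = {C. transpose C = C \<and> (\<forall>v. 0 \<le> v \<bullet> (C *v v))} \<inter> {C. trace C \<le> r} \<inter> {C. e \<le> det C}"
    by auto
  ultimately show ?thesis
    unfolding compact_eq_bounded_closed using closed_Int[OF closed_Int[OF closed_psd]] by simp
qed

section \<open>Sign and convexity of the penalty, strict concavity of \<open>F\<close>\<close>

lemma penalty_nonneg:
  fixes \<mu>0 :: "real ^ 'm"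
  assumes "C0 \<in> spd" "C \<in> spd"
  shows "0 \<le> trace (matrix_inv C0 ** C)" and "0 \<le> penalty \<mu>0 C0 x C"
proof -
  obtain l where l: "l > 0" "\<And>C. (\<And>v. 0 \<le> v \<bullet> (C *v v)) \<Longrightarrow> l * trace C \<le> trace (matrix_inv C0 ** C)"
    using trace_mult_lower_bound[OF spd_matrix_inv[OF assms(1)]] by metis
  have "0 \<le> l * trace C" using l(1) psd_trace_nonneg[OF spd_imp_nonneg[OF assms(2)]] by simp
  also have "\<dots> \<le> trace (matrix_inv C0 ** C)" by (rule l(2)[OF spd_imp_nonneg[OF assms(2)]])
  finally show tr: "0 \<le> trace (matrix_inv C0 ** C)" .
  show "0 \<le> penalty \<mu>0 C0 x C"
    using tr spd_imp_nonneg[OF spd_matrix_inv[OF assms(1)]] by (simp add: penalty_def add_nonneg_nonneg)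
qed

text \<open>The trace is linear in \<open>C\<close>, so the whole convexity defect comes from the
  parallelogram identity for the quadratic form in \<open>x\<close>.\<close>

lemma penalty_midpoint:
  fixes \<mu>0 :: "real ^ 'm"
  assumes "C0 \<in> spd"
  shows "penalty \<mu>0 C0 ((1/2) *\<^sub>R (x + z)) ((1/2) *\<^sub>R (C + D)) =
    (penalty \<mu>0 C0 x C + penalty \<mu>0 C0 z D) / 2 - (x - z) \<bullet> (matrix_inv C0 *v (x - z)) / 4"
proof -
  define K where "K = matrix_inv C0"
  have sym: "transpose K = K" unfolding K_def by (intro spd_imp_sym spd_matrix_inv assms)
  have mid: "(1/2) *\<^sub>R (x + z) - \<mu>0 = (z - \<mu>0) + (1/2) *\<^sub>R (x - z)"
    by (simp add: vec_eq_iff field_simps)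
  have x: "x - \<mu>0 = (z - \<mu>0) + 1 *\<^sub>R (x - z)" by simp
  have "trace (K ** ((1/2) *\<^sub>R (C + D))) = (trace (K ** C) + trace (K ** D)) / 2"
    by (simp add: trace_def matrix_matrix_mult_def sum.distrib distrib_left flip: sum_divide_distrib)
  then show ?thesis
    unfolding penalty_def K_def[symmetric] mid
    using quadratic_form_add[OF sym, of "z - \<mu>0" "1/2" "x - z"]
      quadratic_form_add[OF sym, of "z - \<mu>0" 1 "x - z", folded x]
    by (simp add: power2_eq_square field_simps)
qed

text \<open>The difference of the two sides is half the square of
  \<open>exp (s / 2) - exp (t / 2)\<close>.\<close>

lemma exp_midpoint_le: "exp ((s + t) / 2) \<le> (exp s + exp t) / 2" for s t :: real
proof -
  have "0 \<le> (exp (s / 2) - exp (t / 2))\<^sup>2" by simp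
  also have "\<dots> = exp s + exp t - 2 * exp ((s + t) / 2)"
    by (simp add: power2_diff add_divide_distrib exp_add flip: exp_double)
  finally show ?thesis by simp
qed

text \<open>Every term is midpoint concave. Strictness comes from \<open>ln det\<close> if the
  matrices differ, and otherwise from the quadratic form in the penalty, since then the vectors
  differ.\<close>

lemma F_midpoint_less:
  fixes A :: "real ^ 'm ^ 'n" and \<mu>0 :: "real ^ 'm"
  assumes C0: "C0 \<in> spd" and \<alpha>: "\<alpha> > 0" and C: "C \<in> spd" and D: "D \<in> spd"
    and ne: "(x, C) \<noteq> (z, D)"
  shows "(F A y \<mu>0 C0 \<alpha> x C + F A y \<mu>0 C0 \<alpha> z D) / 2
    < F A y \<mu>0 C0 \<alpha> ((1/2) *\<^sub>R (x + z)) ((1/2) *\<^sub>R (C + D))"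
proof -
  let ?x = "(1/2) *\<^sub>R (x + z)" and ?C = "(1/2) *\<^sub>R (C + D)"
  define E where "E x C = (\<Sum>i\<in>UNIV. exp (log_mean A i x C))" for x C
  define q where "q = (x - z) \<bullet> (matrix_inv C0 *v (x - z))"
  define c where "c = real CARD('m) / 2 * ln \<alpha> - 1/2 * ln (det C0) + real CARD('m) / 2 - vec 1 \<bullet> ln_vec (fact_vec y)"
  have F: "F A y \<mu>0 C0 \<alpha> x C = real_vec y \<bullet> (A *v x) - E x C - \<alpha> / 2 * penalty \<mu>0 C0 x C + ln (det C) / 2 + c" for x C
    unfolding F_def vec1_inner_exp_vec penalty_def c_def E_def by (simp add: algebra_simps)
  have lin: "real_vec y \<bullet> (A *v ?x) = (real_vec y \<bullet> (A *v x) + real_vec y \<bullet> (A *v z)) / 2"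
    by (simp only: matrix_vector_mult_scaleR matrix_vector_right_distrib inner_scaleR_right inner_add_right)
  have "log_mean A i ?x ?C = (log_mean A i x C + log_mean A i z D) / 2" for i
    unfolding log_mean_scaleR log_mean_add by simp
  then have "E ?x ?C \<le> (\<Sum>i\<in>UNIV. (exp (log_mean A i x C) + exp (log_mean A i z D)) / 2)"
    unfolding E_def by (simp only:) (intro sum_mono exp_midpoint_le)
  also have "\<dots> = (E x C + E z D) / 2"
    by (simp add: E_def sum.distrib flip: sum_divide_distrib)
  finally have E: "E ?x ?C \<le> (E x C + E z D) / 2" .
  have pen: "penalty \<mu>0 C0 ?x ?C = (penalty \<mu>0 C0 x C + penalty \<mu>0 C0 z D) / 2 - q / 4"
    unfolding q_def by (rule penalty_midpoint[OF C0])
  have ld: "(ln (det C) + ln (det D)) / 2 \<le> ln (det ?C)"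
    by (rule spd_ln_det_midpoint(1)[OF C D])
  have q: "0 \<le> q" unfolding q_def by (intro spd_imp_nonneg spd_matrix_inv C0)
  have "0 < q \<or> (ln (det C) + ln (det D)) / 2 < ln (det ?C)"
  proof (cases "C = D")
    case True
    then have "x - z \<noteq> 0" using ne by simp
    then have "0 < q" unfolding q_def by (intro spd_imp_pos spd_matrix_inv C0)
    then show ?thesis ..
  next
    case False
    then show ?thesis using ld spd_ln_det_midpoint(2)[OF C D] by linarith
  qed
  then have "0 < \<alpha> / 8 * q + (ln (det ?C) - (ln (det C) + ln (det D)) / 2) / 2"
    using q ld \<alpha> by (auto intro: add_pos_nonneg add_nonneg_pos)
  moreover have "\<alpha> / 2 * penalty \<mu>0 C0 ?x ?C
      = (\<alpha> / 2 * penalty \<mu>0 C0 x C + \<alpha> / 2 * penalty \<mu>0 C0 z D) / 2 - \<alpha> / 8 * q"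
    unfolding pen by (simp add: field_simps)
  ultimately show ?thesis unfolding F lin using E by (simp add: field_simps)
qed

text \<open>Half of the trace penalty absorbs \<open>ln det C\<close>; what remains of the penalty
  bounds \<open>x\<close> and \<open>trace C\<close>. The bound on \<open>F\<close> from below then
  keeps the determinant away from 0.\<close>

lemma compact_F_superlevel:
  fixes A :: "real ^ 'm ^ 'n" and \<mu>0 :: "real ^ 'm"
  assumes C0: "C0 \<in> spd" and \<alpha>: "\<alpha> > 0"
  shows "compact {z. snd z \<in> spd \<and> c \<le> F A y \<mu>0 C0 \<alpha> (fst z) (snd z)}" (is "compact ?L")
proof -
  define K where "K = matrix_inv C0"
  have K: "K \<in> spd" unfolding K_def by (rule spd_matrix_inv[OF C0])
  obtain l1 where l1: "l1 > 0" "\<And>v. l1 * (norm v)\<^sup>2 \<le> v \<bullet> (K *v v)"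
    using spd_quadratic_form_lower_bound[OF K] by metis
  obtain l2 where l2: "l2 > 0" "\<And>C. (\<And>v. 0 \<le> v \<bullet> (C *v v)) \<Longrightarrow> l2 * trace C \<le> trace (K ** C)"
    using trace_mult_lower_bound[OF K] by metis
  obtain B where B: "\<And>x C. C \<in> spd \<Longrightarrow>
      F A y \<mu>0 C0 \<alpha> x C \<le> B + ln (det C) / 2 - \<alpha> / 2 * penalty \<mu>0 C0 x C"
    using F_upper_bound by metis
  \<comment> \<open>The constant is that of the Gibbs-type inequality for \<open>C\<close> and
    \<open>(\<alpha> / 2) *\<^sub>R K\<close>, halved: it gives
    \<open>ln (det C) / 2 \<le> \<alpha> / 4 * t + b\<close> with \<open>t = trace (K ** C)\<close>,
    leaving \<open>\<alpha> / 4 * t\<close> of the penalty.\<close>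
  define b where "b = - (ln (det ((\<alpha> / 2) *\<^sub>R K)) + real CARD('m)) / 2"
  define r where "r = B + b - c"
  \<comment> \<open>The radius and the trace bound come from
    \<open>\<alpha> / 2 * q + \<alpha> / 4 * t \<le> r\<close> below; the determinant bound comes
    from dropping the nonnegative penalty in the upper bound for \<open>F\<close>.\<close>
  define T where "T = cball \<mu>0 (sqrt (2 * r / (\<alpha> * l1))) \<times>
    {C :: real ^ 'm ^ 'm. transpose C = C \<and> (\<forall>v. 0 \<le> v \<bullet> (C *v v)) \<and> trace C \<le> 4 * r / (\<alpha> * l2) \<and> exp (2 * (c - B)) \<le> det C}"
  have cT: "compact T" unfolding T_def by (intro compact_Times compact_cball compact_psd_trace_det)
  have T_spd: "T \<subseteq> UNIV \<times> spd"
  proof -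
    have "det C \<noteq> 0" if "exp (2 * (c - B)) \<le> det C" for C :: "real ^ 'm ^ 'm"
      using that exp_gt_zero[of "2 * (c - B)"] by linarith
    then show ?thesis unfolding T_def by (auto intro: psd_det_nonzero_imp_spd)
  qed
  have "?L \<subseteq> T"
  proof safe
    fix x :: "real ^ 'm" and C :: "real ^ 'm ^ 'm"
    assume "snd (x, C) \<in> spd" "c \<le> F A y \<mu>0 C0 \<alpha> (fst (x, C)) (snd (x, C))"
    then have C: "C \<in> spd" and le: "c \<le> B + ln (det C) / 2 - \<alpha> / 2 * penalty \<mu>0 C0 x C"
      using B[of C x] by auto
    define q where "q = (x - \<mu>0) \<bullet> (K *v (x - \<mu>0))"
    define t where "t = trace (K ** C)"
    have pen: "penalty \<mu>0 C0 x C = q + t" by (simp add: penalty_def q_def t_def K_def)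
    have q: "0 \<le> q" unfolding q_def by (rule spd_imp_nonneg[OF K])
    have t: "0 \<le> t" unfolding t_def K_def by (rule penalty_nonneg(1)[OF C0 C])
    have "trace ((\<alpha> / 2) *\<^sub>R K ** C) = \<alpha> / 2 * t"
      by (simp add: t_def trace_def matrix_matrix_mult_def sum_distrib_left mult_ac)
    moreover have "(\<alpha> / 2) *\<^sub>R K \<in> spd" using K \<alpha> by (simp add: spd_scaleR)
    from spd_ln_det_add_le_trace(1)[OF C this]
    have "ln (det C) + ln (det ((\<alpha> / 2) *\<^sub>R K)) \<le> trace ((\<alpha> / 2) *\<^sub>R K ** C) - real CARD('m)" .
    ultimately have "ln (det C) / 2 \<le> \<alpha> / 4 * t + b"
      unfolding b_def by (simp add: field_simps)
    then have r: "\<alpha> / 2 * q + \<alpha> / 4 * t \<le> r"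
      using le unfolding pen r_def by (simp add: field_simps)
    have "\<alpha> / 2 * q \<le> r" using r t \<alpha> by (smt (verit) mult_nonneg_nonneg divide_nonneg_pos)
    moreover have "\<alpha> / 2 * (l1 * (norm (x - \<mu>0))\<^sup>2) \<le> \<alpha> / 2 * q"
      unfolding q_def using \<alpha> l1 by (intro mult_left_mono) auto
    ultimately have "\<alpha> / 2 * (l1 * (norm (x - \<mu>0))\<^sup>2) \<le> r" by linarith
    then have "(norm (x - \<mu>0))\<^sup>2 \<le> 2 * r / (\<alpha> * l1)" using \<alpha> l1(1) by (simp add: field_simps)
    then have 1: "x \<in> cball \<mu>0 (sqrt (2 * r / (\<alpha> * l1)))"
      by (simp add: dist_norm norm_minus_commute real_le_rsqrt)
    have "\<alpha> / 4 * t \<le> r" using r q \<alpha> by (smt (verit) mult_nonneg_nonneg divide_nonneg_pos)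
    moreover have "\<alpha> / 4 * (l2 * trace C) \<le> \<alpha> / 4 * t"
      unfolding t_def using \<alpha> l2(2)[OF spd_imp_nonneg[OF C]] by (intro mult_left_mono) auto
    ultimately have "\<alpha> / 4 * (l2 * trace C) \<le> r" by linarith
    then have 2: "trace C \<le> 4 * r / (\<alpha> * l2)" using \<alpha> l2(1) by (simp add: field_simps)
    have "0 \<le> \<alpha> / 2 * penalty \<mu>0 C0 x C" using \<alpha> q t unfolding pen by simp
    then have "2 * (c - B) \<le> ln (det C)" using le by simp
    then have 3: "exp (2 * (c - B)) \<le> det C"
      using spd_det_pos[OF C] by (metis exp_le_cancel_iff exp_ln)
    show "(x, C) \<in> T"
      unfolding T_def using 1 2 3 spd_imp_sym[OF C] spd_imp_nonneg[OF C] by simp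
  qed
  \<comment> \<open>Since \<open>T\<close> is closed and \<open>F\<close> is continuous on it,
    closedness of the superlevel set follows although \<open>spd\<close> itself is not
    closed.\<close>
  then have "?L = {z \<in> T. c \<le> F A y \<mu>0 C0 \<alpha> (fst z) (snd z)}" using T_spd by auto
  moreover have "closed \<dots>"
    using cT continuous_on_subset[OF continuous_on_F T_spd]
    by (intro continuous_on_closed_Collect_le compact_imp_closed continuous_on_const)
  ultimately have "closed ?L" by simp
  with cT have "compact (T \<inter> ?L)" by (rule compact_Int_closed)
  then show ?thesis using \<open>?L \<subseteq> T\<close> by (simp only: inf.absorb2)
qed

section \<open>Existence and uniqueness of the maximizer\<close>

lemma
  fixes A :: "real ^ 'm ^ 'n" and \<mu>0 :: "real ^ 'm"
  assumes C0: "C0 \<in> spd" and \<alpha>: "\<alpha> > 0"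
  shows Cov_spd: "Cov A y \<mu>0 C0 \<alpha> \<in> spd"
    and F_le_maximum: "\<And>x C. C \<in> spd \<Longrightarrow>
      F A y \<mu>0 C0 \<alpha> x C \<le> F A y \<mu>0 C0 \<alpha> (xbar A y \<mu>0 C0 \<alpha>) (Cov A y \<mu>0 C0 \<alpha>)"
proof -
  let ?f = "\<lambda>z. F A y \<mu>0 C0 \<alpha> (fst z) (snd z)"
  let ?P = "\<lambda>z. snd z \<in> spd"
  \<comment> \<open>The point \<open>(\<mu>0, C0)\<close> makes this compact set nonempty, and
    points outside it have smaller values, so a maximum over \<open>L\<close> is a maximum over all
    of \<open>spd\<close>.\<close>
  define L where "L = {z. snd z \<in> spd \<and> ?f (\<mu>0, C0) \<le> ?f z}"
  have "compact L" unfolding L_def by (rule compact_F_superlevel[OF C0 \<alpha>])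
  moreover have "L \<noteq> {}" using C0 by (auto simp: L_def)
  moreover have "continuous_on L ?f"
    by (rule continuous_on_subset[OF continuous_on_F]) (auto simp: L_def)
  ultimately obtain z where z: "z \<in> L" "\<And>w. w \<in> L \<Longrightarrow> ?f w \<le> ?f z"
    using continuous_attains_sup[of L ?f] by blast
  then have "?f w \<le> ?f z" if "snd w \<in> spd" for w
    using that by (cases "w \<in> L") (auto simp: L_def)
  then have "is_arg_max ?f ?P z" using z(1) by (auto simp: is_arg_max_def L_def not_less)
  \<comment> \<open>Existence of one maximizer makes the choice operator return a maximizer.\<close>
  then have "is_arg_max ?f ?P (arg_max ?f ?P)" unfolding arg_max_def by (rule someI)
  moreover have "maximizer A y \<mu>0 C0 \<alpha> = arg_max ?f ?P"
    by (simp add: maximizer_def case_prod_beta')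
  ultimately have *: "is_arg_max ?f ?P (maximizer A y \<mu>0 C0 \<alpha>)" by simp
  then show "Cov A y \<mu>0 C0 \<alpha> \<in> spd" by (simp add: is_arg_max_def Cov_def)
  fix x :: "real ^ 'm" and C :: "real ^ 'm ^ 'm" assume "C \<in> spd"
  with * show "F A y \<mu>0 C0 \<alpha> x C \<le> F A y \<mu>0 C0 \<alpha> (xbar A y \<mu>0 C0 \<alpha>) (Cov A y \<mu>0 C0 \<alpha>)"
    unfolding is_arg_max_def xbar_def Cov_def by (metis fst_conv snd_conv not_less)
qed

text \<open>The midpoint of two distinct maximizers would have a strictly larger value.\<close>

lemma maximizer_unique:
  fixes A :: "real ^ 'm ^ 'n" and \<mu>0 :: "real ^ 'm"
  assumes C0: "C0 \<in> spd" and \<alpha>: "\<alpha> > 0" and C: "C \<in> spd"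
    and ge: "F A y \<mu>0 C0 \<alpha> (xbar A y \<mu>0 C0 \<alpha>) (Cov A y \<mu>0 C0 \<alpha>) \<le> F A y \<mu>0 C0 \<alpha> x C"
  shows "x = xbar A y \<mu>0 C0 \<alpha>" and "C = Cov A y \<mu>0 C0 \<alpha>"
proof -
  let ?x = "xbar A y \<mu>0 C0 \<alpha>" and ?C = "Cov A y \<mu>0 C0 \<alpha>"
  have "(x, C) = (?x, ?C)"
  proof (rule ccontr)
    assume "(x, C) \<noteq> (?x, ?C)"
    from F_midpoint_less[OF C0 \<alpha> C Cov_spd[OF C0 \<alpha>] this, of A y \<mu>0]
      F_le_maximum[OF C0 \<alpha>, of "(1/2) *\<^sub>R (C + ?C)" A y \<mu>0 "(1/2) *\<^sub>R (x + ?x)"]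
      spd_scaleR[OF spd_add[OF C Cov_spd[OF C0 \<alpha>]], of "1/2"]
    show False using ge by fastforce
  qed
  then show "x = ?x" "C = ?C" by auto
qed

section \<open>The iteration in alpha\<close>

definition opt_penalty ::
  "real ^ 'm ^ 'n \<Rightarrow> nat ^ 'n \<Rightarrow> real ^ 'm \<Rightarrow> real ^ 'm ^ 'm \<Rightarrow> real \<Rightarrow> real" where
  "opt_penalty A y \<mu>0 C0 \<alpha> = penalty \<mu>0 C0 (xbar A y \<mu>0 C0 \<alpha>) (Cov A y \<mu>0 C0 \<alpha>)"

lemma alpha_update_eq:
  fixes \<mu>0 :: "real ^ 'm"
  shows "alpha_update A y \<mu>0 C0 a b \<alpha> = (real CARD('m) + 2 * (a - 1)) / (opt_penalty A y \<mu>0 C0 \<alpha> + 2 * b)"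
  by (simp add: alpha_update_def opt_penalty_def penalty_def)

lemma opt_penalty_nonneg:
  assumes "C0 \<in> spd" "\<alpha> > 0" shows "0 \<le> opt_penalty A y \<mu>0 C0 \<alpha>"
  unfolding opt_penalty_def by (intro penalty_nonneg(2) Cov_spd assms)

text \<open>This is optimality of the \<beta>-maximizer for its own problem, rewritten at parameter
  \<alpha>; the logarithmic terms cancel. It bounds how far that point is from optimal for
  \<alpha>.\<close>

lemma F_at_other_maximizer:
  assumes C0: "C0 \<in> spd" and "\<alpha> > 0" "\<beta> > 0"
  shows "F A y \<mu>0 C0 \<alpha> (xbar A y \<mu>0 C0 \<alpha>) (Cov A y \<mu>0 C0 \<alpha>)
      - (\<beta> - \<alpha>) / 2 * (opt_penalty A y \<mu>0 C0 \<alpha> - opt_penalty A y \<mu>0 C0 \<beta>)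
    \<le> F A y \<mu>0 C0 \<alpha> (xbar A y \<mu>0 C0 \<beta>) (Cov A y \<mu>0 C0 \<beta>)"
proof -
  have "F A y \<mu>0 C0 \<beta> (xbar A y \<mu>0 C0 \<alpha>) (Cov A y \<mu>0 C0 \<alpha>)
      \<le> F A y \<mu>0 C0 \<beta> (xbar A y \<mu>0 C0 \<beta>) (Cov A y \<mu>0 C0 \<beta>)"
    using assms by (intro F_le_maximum Cov_spd)
  then show ?thesis
    unfolding F_change_alpha[of A y \<mu>0 C0 \<beta> _ _ \<alpha>] opt_penalty_def by (simp add: algebra_simps)
qed

text \<open>Optimality for \<alpha> makes the gap in the preceding bound nonnegative, so the change
  in parameter and the drop in penalty have the same sign.\<close>

lemma opt_penalty_antimono:
  assumes C0: "C0 \<in> spd" and "0 < \<alpha>" "\<alpha> \<le> \<beta>"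
  shows "opt_penalty A y \<mu>0 C0 \<beta> \<le> opt_penalty A y \<mu>0 C0 \<alpha>"
proof (cases "\<alpha> = \<beta>")
  case False
  have "F A y \<mu>0 C0 \<alpha> (xbar A y \<mu>0 C0 \<beta>) (Cov A y \<mu>0 C0 \<beta>)
      \<le> F A y \<mu>0 C0 \<alpha> (xbar A y \<mu>0 C0 \<alpha>) (Cov A y \<mu>0 C0 \<alpha>)"
    using assms by (intro F_le_maximum Cov_spd) auto
  with F_at_other_maximizer[OF C0, of \<alpha> \<beta> A y \<mu>0] assms
  have "0 \<le> (\<beta> - \<alpha>) * (opt_penalty A y \<mu>0 C0 \<alpha> - opt_penalty A y \<mu>0 C0 \<beta>)" by simp
  then show ?thesis using False assms by (simp add: zero_le_mult_iff)
qed simp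

text \<open>Along the sequence the maximizers for \<open>X k\<close> are almost optimal for the limit problem,
  so they accumulate, by compactness, only at its unique maximizer.\<close>

lemma opt_penalty_limit:
  assumes C0: "C0 \<in> spd" and X: "\<And>k. X k > 0" and lim: "X \<longlonglongrightarrow> L" and L: "L > 0"
    and P: "(\<lambda>k. opt_penalty A y \<mu>0 C0 (X k)) \<longlonglongrightarrow> P"
  shows "P = opt_penalty A y \<mu>0 C0 L"
proof -
  define z where "z k = (xbar A y \<mu>0 C0 (X k), Cov A y \<mu>0 C0 (X k))" for k
  define f where "f w = F A y \<mu>0 C0 L (fst w) (snd w)" for w
  define V where "V = F A y \<mu>0 C0 L (xbar A y \<mu>0 C0 L) (Cov A y \<mu>0 C0 L)"
  \<comment> \<open>This bounds the optimality gap of \<open>z k\<close> in the limit problem. It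
    tends to 0 because the penalties converge and so stay bounded.\<close>
  define \<delta> where "\<delta> k = (X k - L) / 2 * (opt_penalty A y \<mu>0 C0 L - opt_penalty A y \<mu>0 C0 (X k))" for k
  have "\<delta> \<longlonglongrightarrow> (L - L) / 2 * (opt_penalty A y \<mu>0 C0 L - P)"
    unfolding \<delta>_def by (intro tendsto_intros lim P) simp
  then have \<delta>: "\<delta> \<longlonglongrightarrow> 0" by simp
  have fz: "V - \<delta> k \<le> f (z k)" for k
    unfolding V_def \<delta>_def f_def z_def using F_at_other_maximizer[OF C0 L X] by simp
  \<comment> \<open>From \<open>k0\<close> on all maximizers lie in the superlevel set at
    \<open>V - 1\<close>, one fixed compact set.\<close>
  from order_tendstoD(2)[OF \<delta>, of 1] obtain k0 where k0: "\<And>k. k \<ge> k0 \<Longrightarrow> \<delta> k < 1"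
    by (auto simp: eventually_sequentially)
  define S where "S = {w. snd w \<in> spd \<and> V - 1 \<le> f w}"
  have "compact S" unfolding S_def f_def by (rule compact_F_superlevel[OF C0 L])
  moreover have zS: "z (k + k0) \<in> S" for k
    using fz[of "k + k0"] k0[of "k + k0"] Cov_spd[OF C0 X] by (simp add: S_def z_def)
  ultimately obtain w r where w: "w \<in> S" and r: "strict_mono r" and zw: "((\<lambda>k. z (k + k0)) \<circ> r) \<longlonglongrightarrow> w"
    by (metis compact_imp_seq_compact seq_compactE)
  define s where "s k = r k + k0" for k
  have s: "strict_mono s" using r by (simp add: s_def strict_mono_def)
  have zw: "(\<lambda>k. z (s k)) \<longlonglongrightarrow> w" using zw by (simp add: s_def o_def)
  have zs: "z (s k) \<in> S" for k unfolding s_def by (rule zS)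
  have "continuous_on S f"
    unfolding f_def by (rule continuous_on_subset[OF continuous_on_F]) (auto simp: S_def)
  then have "(\<lambda>k. f (z (s k))) \<longlonglongrightarrow> f w"
    using w(1) zs by (intro continuous_on_tendsto_compose[OF _ zw]) auto
  moreover have "(\<lambda>k. V - \<delta> (s k)) \<longlonglongrightarrow> V - 0"
    using LIMSEQ_subseq_LIMSEQ[OF \<delta> s] by (intro tendsto_intros) (simp add: o_def)
  ultimately have "V \<le> f w" using fz by (intro LIMSEQ_le[of "\<lambda>k. V - \<delta> (s k)"]) auto
  then have wL: "w = (xbar A y \<mu>0 C0 L, Cov A y \<mu>0 C0 L)"
    using maximizer_unique[OF C0 L, of "snd w" A y \<mu>0 "fst w"] w by (simp add: f_def V_def S_def prod_eq_iff)
  have "(\<lambda>k. penalty \<mu>0 C0 (fst (z (s k))) (snd (z (s k)))) \<longlonglongrightarrow> penalty \<mu>0 C0 (fst w) (snd w)"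
    using zw by (intro continuous_on_tendsto_compose[OF continuous_on_penalty]) auto
  then have "(\<lambda>k. opt_penalty A y \<mu>0 C0 (X (s k))) \<longlonglongrightarrow> opt_penalty A y \<mu>0 C0 L"
    by (simp add: z_def wL opt_penalty_def)
  moreover have "(\<lambda>k. opt_penalty A y \<mu>0 C0 (X (s k))) \<longlonglongrightarrow> P"
    using LIMSEQ_subseq_LIMSEQ[OF P s] by (simp add: o_def)
  ultimately show ?thesis using LIMSEQ_unique by blast
qed

text \<open>A nondecreasing map preserves the order of consecutive iterates, so the first step fixes
  the direction of the whole orbit.\<close>

lemma monoseq_mono_iteration:
  fixes X :: "nat \<Rightarrow> real"
  assumes mono: "\<And>s t. 0 < s \<Longrightarrow> s \<le> t \<Longrightarrow> T s \<le> T t"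
    and pos: "\<And>k. 0 < X k" and step: "\<And>k. X (Suc k) = T (X k)"
  shows "monoseq X"
proof (cases "X 0 \<le> X (Suc 0)")
  case True
  have "X k \<le> X (Suc k)" for k
    by (induction k) (use True mono pos step in auto)
  then show ?thesis by (simp add: monoseq_Suc)
next
  case False
  have "X (Suc k) \<le> X k" for k
  proof (induction k)
    case (Suc k)
    then show ?case using mono[OF pos] step by metis
  qed (use False in simp)
  then show ?thesis by (simp add: monoseq_Suc)
qed

theorem theorem5p1:
  fixes A :: "real ^ 'm ^ 'n" and y :: "nat ^ 'n"
    and \<mu>0 :: "real ^ 'm" and C0 :: "real ^ 'm ^ 'm"
    and a b :: real and \<alpha> :: "nat \<Rightarrow> real"
  assumes "C0 \<in> spd"
    and "a > 0" and "b > 0"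
    and "0 \<le> real CARD('m) + 2 * (a - 1)"
    and "\<alpha> 1 > 0"
    and "\<And>k. k \<ge> 1 \<Longrightarrow> \<alpha> (k + 1) = alpha_update A y \<mu>0 C0 a b (\<alpha> k)"
  shows "monoseq (\<lambda>k. \<alpha> (k + 1)) \<and>
    (\<exists>\<alpha>s\<ge>0. \<alpha> \<longlonglongrightarrow> \<alpha>s \<and>
       (\<alpha>s > 0 \<longrightarrow> \<alpha>s = alpha_update A y \<mu>0 C0 a b \<alpha>s))"
proof -
  define N where "N = real CARD('m) + 2 * (a - 1)"
  \<comment> \<open>The shift starts the iteration at index 0; the value \<open>\<alpha> 0\<close>
    is arbitrary and does not affect the limit.\<close>
  define X where "X k = \<alpha> (k + 1)" for k
  define p where "p = opt_penalty A y \<mu>0 C0"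
  have upd: "alpha_update A y \<mu>0 C0 a b s = N / (p s + 2 * b)" for s
    by (simp add: alpha_update_eq N_def p_def)
  have step: "X (Suc k) = N / (p (X k) + 2 * b)" for k
    using assms(6)[of "k + 1"] by (simp add: X_def upd)
  have X0: "X 0 > 0" using assms(5) by (simp add: X_def)
  have limI: "\<alpha> \<longlonglongrightarrow> s" if "X \<longlonglongrightarrow> s" for s
    using that LIMSEQ_offset[of \<alpha> 1] unfolding X_def by blast
  show ?thesis
  \<comment> \<open>If the numerator vanishes, all terms after the first are 0. The maximizer
    carries no meaning at parameter 0, but a quotient with numerator 0 is 0 whatever its
    denominator.\<close>
  proof (cases "N = 0")
    case True
    then have 0: "X (Suc k) = 0" for k using step by simp
    have "X (Suc k) \<le> X k" for k using 0 X0 by (cases k) (simp_all only: less_imp_le order_refl)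
    then have "monoseq X" by (simp add: monoseq_Suc)
    moreover have "X \<longlonglongrightarrow> 0" by (rule LIMSEQ_imp_Suc) (simp add: 0)
    ultimately show ?thesis using limI unfolding X_def by blast
  next
    case False
    then have N: "N > 0" using assms(4) by (simp add: N_def)
    have den: "p s + 2 * b > 0" "2 * b \<le> p s + 2 * b" if "s > 0" for s
      using opt_penalty_nonneg[OF assms(1) that, of A y \<mu>0] assms(3) unfolding p_def by linarith+
    have pos: "X k > 0" for k
      by (induction k) (use X0 step N den in auto)
    have "monoseq X"
    proof (rule monoseq_mono_iteration[where X = X and T = "\<lambda>s. N / (p s + 2 * b)", OF _ pos step])
      fix s t :: real assume st: "0 < s" "s \<le> t"
      have "p t \<le> p s" unfolding p_def by (rule opt_penalty_antimono[OF assms(1) st])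
      then show "N / (p s + 2 * b) \<le> N / (p t + 2 * b)"
        using N den(1)[of s] den(1)[of t] st by (intro divide_left_mono) auto
    qed
    moreover have "Bseq X"
    proof -
      \<comment> \<open>The bound holds for images of the update only; the initial guess may exceed
        it.\<close>
      have "X (Suc k) \<le> N / (2 * b)" for k
        unfolding step using N den[OF pos] assms(3) by (intro divide_left_mono) auto
      then have "norm (X (Suc k)) \<le> N / (2 * b)" for k using pos[of "Suc k"] by simp
      then show ?thesis using BseqI'[of "\<lambda>k. X (Suc k)"] Bseq_Suc_iff by blast
    qed
    ultimately obtain L where L: "X \<longlonglongrightarrow> L"
      using Bseq_monoseq_convergent convergent_def by blast
    have "0 \<le> L" using L pos by (intro LIMSEQ_le_const[of X]) (auto intro: less_imp_le)
    moreover have "L = alpha_update A y \<mu>0 C0 a b L" if "L > 0"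
    proof -
      \<comment> \<open>Solving the update for the penalty shows that \<open>p (X k)\<close>
        converges as soon as the iterates have a positive limit; this is the hypothesis under which
        its limit is identified as \<open>p L\<close>.\<close>
      have "p (X k) = N / X (Suc k) - 2 * b" for k
        using step[of k] pos[of "Suc k"] N den(1)[OF pos[of k]] by (simp add: field_simps)
      moreover have "(\<lambda>k. N / X (Suc k) - 2 * b) \<longlonglongrightarrow> N / L - 2 * b"
        using that LIMSEQ_Suc[OF L] by (intro tendsto_intros) auto
      ultimately have "(\<lambda>k. p (X k)) \<longlonglongrightarrow> N / L - 2 * b" by simp
      then have "N / L - 2 * b = p L"
        unfolding p_def by (rule opt_penalty_limit[OF assms(1) pos L that])
      then have "p L + 2 * b = N / L" by simp
      then show ?thesis unfolding upd using N that by simp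
    qed
    ultimately show ?thesis using \<open>monoseq X\<close> limI[OF L] unfolding X_def by blast
  qed
qed

end
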